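(* Let $\psi:R\to A$ be a homomorphism of commutative rings, and set $X:=\operatorname{Spec} R$ and $Y:=\operatorname{Spec} A$. Suppose that $X$ is connected and that for all $\mathfrak p\in X$ the space $\operatorname{Spec} A_{\mathfrak p}$ is connected, where $A_{\mathfrak p}:=A_{R\setminus\mathfrak p}$ is the localization of $A$ at the image under $\psi$ of the multiplicative system $R\setminus\mathfrak p$. Then $Y$ is connected.
   Context: The empty topological space is not considered connected (so $\operatorname{Spec}$ of a ring is connected iff the ring is nonzero and its only idempotents are $0$ and $1$). *)

theory Defs
  imports "HOL-Algebra.RingHom" "HOL-Analysis.Abstract_Topology"
begin

section \<open>The prime spectrum\<close>

definition prime_ideals :: "('a, 'm) ring_scheme \<Rightarrow> 'a set set" where
  "prime_ideals R = {P. primeideal P R}"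

text \<open>The Zariski topology: the closed sets are the sets of primes containing a given
  set \<open>E\<close> of ring elements.\<close>

definition Spec :: "('a, 'm) ring_scheme \<Rightarrow> 'a set topology" where
  "Spec R = topology (\<lambda>U. \<exists>E \<subseteq> carrier R. U = {P \<in> prime_ideals R. \<not> E \<subseteq> P})"

lemma istopology_zariski:
  "istopology (\<lambda>U. \<exists>E \<subseteq> carrier R. U = {P \<in> prime_ideals R. \<not> E \<subseteq> P})"
proof -
  have "\<exists>G \<subseteq> carrier R. {P \<in> prime_ideals R. \<not> E \<subseteq> P} \<inter> {P \<in> prime_ideals R. \<not> F \<subseteq> P}
      = {P \<in> prime_ideals R. \<not> G \<subseteq> P}"
    if E: "E \<subseteq> carrier R" and F: "F \<subseteq> carrier R" for E F
  proof -
    let ?G = "{e \<otimes>\<^bsub>R\<^esub> f | e f. e \<in> E \<and> f \<in> F}"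
    have "\<not> ?G \<subseteq> P \<longleftrightarrow> \<not> E \<subseteq> P \<and> \<not> F \<subseteq> P" if "P \<in> prime_ideals R" for P
    proof -
      interpret primeideal P R using that by (simp add: prime_ideals_def)
      show ?thesis
      proof
        assume "\<not> ?G \<subseteq> P"
        then obtain e f where ef: "e \<in> E" "f \<in> F" "e \<otimes>\<^bsub>R\<^esub> f \<notin> P" by auto
        then have "e \<in> carrier R" "f \<in> carrier R" using E F by auto
        then show "\<not> E \<subseteq> P \<and> \<not> F \<subseteq> P"
          using ef I_l_closed I_r_closed by blast
      next
        assume "\<not> E \<subseteq> P \<and> \<not> F \<subseteq> P"
        then obtain e f where ef: "e \<in> E" "e \<notin> P" "f \<in> F" "f \<notin> P" by auto
        then have "e \<in> carrier R" "f \<in> carrier R" using E F by auto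
        then have "e \<otimes>\<^bsub>R\<^esub> f \<notin> P" using I_prime ef by blast
        then show "\<not> ?G \<subseteq> P" using ef by blast
      qed
    qed
    then have eq: "{P \<in> prime_ideals R. \<not> E \<subseteq> P} \<inter> {P \<in> prime_ideals R. \<not> F \<subseteq> P}
        = {P \<in> prime_ideals R. \<not> ?G \<subseteq> P}" by blast
    show ?thesis
    proof (cases "prime_ideals R = {}")
      case True
      then show ?thesis by blast
    next
      case False
      then obtain P where "primeideal P R" by (auto simp: prime_ideals_def)
      then interpret primeideal P R .
      have "?G \<subseteq> carrier R" using E F by auto
      with eq show ?thesis by blast
    qed
  qed
  moreover have "\<exists>G \<subseteq> carrier R. \<Union>\<K> = {P \<in> prime_ideals R. \<not> G \<subseteq> P}"
    if K: "\<And>K. K \<in> \<K> \<Longrightarrow> \<exists>E \<subseteq> carrier R. K = {P \<in> prime_ideals R. \<not> E \<subseteq> P}" for \<K>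
  proof -
    let ?G = "\<Union>{E. E \<subseteq> carrier R \<and> {P \<in> prime_ideals R. \<not> E \<subseteq> P} \<in> \<K>}"
    have "\<Union>\<K> = {P \<in> prime_ideals R. \<not> ?G \<subseteq> P}"
    proof
      show "\<Union>\<K> \<subseteq> {P \<in> prime_ideals R. \<not> ?G \<subseteq> P}"
      proof
        fix P assume "P \<in> \<Union>\<K>"
        then obtain K where "K \<in> \<K>" "P \<in> K" by blast
        moreover obtain E where "E \<subseteq> carrier R" "K = {P \<in> prime_ideals R. \<not> E \<subseteq> P}"
          using K[OF \<open>K \<in> \<K>\<close>] by blast
        ultimately show "P \<in> {P \<in> prime_ideals R. \<not> ?G \<subseteq> P}" by blast
      qed
      show "{P \<in> prime_ideals R. \<not> ?G \<subseteq> P} \<subseteq> \<Union>\<K>" by blast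
    qed
    then show ?thesis by (intro exI[of _ ?G]) auto
  qed
  ultimately show ?thesis
    unfolding istopology_def by (auto 0 3)
qed

lemma openin_Spec:
  "openin (Spec R) U \<longleftrightarrow> (\<exists>E \<subseteq> carrier R. U = {P \<in> prime_ideals R. \<not> E \<subseteq> P})"
  unfolding Spec_def by (simp add: istopology_zariski)

lemma topspace_Spec: "topspace (Spec R) = prime_ideals R"
proof
  show "topspace (Spec R) \<subseteq> prime_ideals R"
    by (auto simp: topspace_def openin_Spec)
  have "{P \<in> prime_ideals R. \<not> carrier R \<subseteq> P} = prime_ideals R"
  proof -
    have "\<not> carrier R \<subseteq> P" if "P \<in> prime_ideals R" for P
    proof -
      interpret primeideal P R using that by (simp add: prime_ideals_def)
      show ?thesis using I_notcarr a_subset by blast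
    qed
    then show ?thesis by blast
  qed
  then have "openin (Spec R) (prime_ideals R)" unfolding openin_Spec by blast
  then show "prime_ideals R \<subseteq> topspace (Spec R)" by (rule openin_subset)
qed

text \<open>\<^const>\<open>connected_space\<close> holds for the empty space; here the empty space is not
  considered connected.\<close>

definition nonempty_connected_space :: "'a topology \<Rightarrow> bool" where
  "nonempty_connected_space T \<longleftrightarrow> topspace T \<noteq> {} \<and> connected_space T"


section \<open>Localization of a commutative ring at a multiplicative system\<close>

text \<open>The pair \<open>(a, s)\<close> represents the fraction \<open>a / s\<close>.  The factor \<open>u\<close> is needed since
  the multiplicative system may contain zero divisors (and even zero, in which case the
  localization is the zero ring).\<close>

definition frac_rel :: "('a, 'm) ring_scheme \<Rightarrow> 'a set \<Rightarrow> (('a \<times> 'a) \<times> ('a \<times> 'a)) set" where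
  "frac_rel R S = {((a, s), (b, t)). a \<in> carrier R \<and> s \<in> S \<and> b \<in> carrier R \<and> t \<in> S \<and>
     (\<exists>u \<in> S. u \<otimes>\<^bsub>R\<^esub> (t \<otimes>\<^bsub>R\<^esub> a) = u \<otimes>\<^bsub>R\<^esub> (s \<otimes>\<^bsub>R\<^esub> b))}"

definition fraction :: "('a, 'm) ring_scheme \<Rightarrow> 'a set \<Rightarrow> 'a \<Rightarrow> 'a \<Rightarrow> ('a \<times> 'a) set" where
  "fraction R S a s = frac_rel R S `` {(a, s)}"

text \<open>In the sum and the product all members of the union are equal, see
  \<open>localization_add\<close> and \<open>localization_mult\<close> below.\<close>

definition localization :: "('a, 'm) ring_scheme \<Rightarrow> 'a set \<Rightarrow> ('a \<times> 'a) set ring" where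
  "localization R S =
    \<lparr> carrier = (carrier R \<times> S) // frac_rel R S,
      mult = (\<lambda>C D. \<Union>(a, s) \<in> C. \<Union>(b, t) \<in> D. fraction R S (a \<otimes>\<^bsub>R\<^esub> b) (s \<otimes>\<^bsub>R\<^esub> t)),
      one = fraction R S \<one>\<^bsub>R\<^esub> \<one>\<^bsub>R\<^esub>,
      zero = fraction R S \<zero>\<^bsub>R\<^esub> \<one>\<^bsub>R\<^esub>,
      add = (\<lambda>C D. \<Union>(a, s) \<in> C. \<Union>(b, t) \<in> D.
               fraction R S (a \<otimes>\<^bsub>R\<^esub> t \<oplus>\<^bsub>R\<^esub> b \<otimes>\<^bsub>R\<^esub> s) (s \<otimes>\<^bsub>R\<^esub> t)) \<rparr>"

locale mult_system = cring R + submonoid S R for R (structure) and S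
begin

lemma S_carrier [simp, intro]: "s \<in> S \<Longrightarrow> s \<in> carrier R"
  using subset by blast

lemma equiv_frac_rel: "equiv (carrier R \<times> S) (frac_rel R S)"
proof (rule equivI)
  show "frac_rel R S \<subseteq> (carrier R \<times> S) \<times> (carrier R \<times> S)"
    by (auto simp: frac_rel_def)
  show "refl_on (carrier R \<times> S) (frac_rel R S)"
    by (auto simp: refl_on_def frac_rel_def)
  show "sym (frac_rel R S)"
    by (auto simp: sym_def frac_rel_def) metis
  show "trans (frac_rel R S)"
  proof (rule transI, clarify)
    fix a s b t c w
    assume "((a, s), (b, t)) \<in> frac_rel R S" "((b, t), (c, w)) \<in> frac_rel R S"
    then obtain u v where *: "a \<in> carrier R" "b \<in> carrier R" "c \<in> carrier R"
      "s \<in> S" "t \<in> S" "w \<in> S" "u \<in> S" "v \<in> S"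
      "u \<otimes> (t \<otimes> a) = u \<otimes> (s \<otimes> b)" "v \<otimes> (w \<otimes> b) = v \<otimes> (t \<otimes> c)"
      by (auto simp: frac_rel_def)
    have "(u \<otimes> v \<otimes> t) \<otimes> (w \<otimes> a) = (v \<otimes> w) \<otimes> (u \<otimes> (t \<otimes> a))"
      using *(1-8) by (simp add: m_ac)
    also have "\<dots> = (v \<otimes> w) \<otimes> (u \<otimes> (s \<otimes> b))" by (simp only: *(9))
    also have "\<dots> = (u \<otimes> s) \<otimes> (v \<otimes> (w \<otimes> b))"
      using *(1-8) by (simp add: m_ac)
    also have "\<dots> = (u \<otimes> s) \<otimes> (v \<otimes> (t \<otimes> c))" by (simp only: *(10))
    also have "\<dots> = (u \<otimes> v \<otimes> t) \<otimes> (s \<otimes> c)"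
      using *(1-8) by (simp add: m_ac)
    finally have "(u \<otimes> v \<otimes> t) \<otimes> (w \<otimes> a) = (u \<otimes> v \<otimes> t) \<otimes> (s \<otimes> c)" .
    moreover have "u \<otimes> v \<otimes> t \<in> S" using * by (auto intro: m_closed)
    ultimately show "((a, s), (c, w)) \<in> frac_rel R S"
      unfolding frac_rel_def using * by blast
  qed
qed

lemma fraction_eq_iff:
  assumes "a \<in> carrier R" "s \<in> S" "b \<in> carrier R" "t \<in> S"
  shows "fraction R S a s = fraction R S b t \<longleftrightarrow> (\<exists>u \<in> S. u \<otimes> (t \<otimes> a) = u \<otimes> (s \<otimes> b))"
proof -
  have "fraction R S a s = fraction R S b t \<longleftrightarrow> ((a, s), (b, t)) \<in> frac_rel R S"
    unfolding fraction_def using assms by (intro eq_equiv_class_iff[OF equiv_frac_rel]) auto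
  then show ?thesis using assms by (simp add: frac_rel_def)
qed

lemma fraction_eqI:
  assumes "a \<in> carrier R" "s \<in> S" "b \<in> carrier R" "t \<in> S" "t \<otimes> a = s \<otimes> b"
  shows "fraction R S a s = fraction R S b t"
  using assms by (auto simp: fraction_eq_iff)

lemma localization_carrier:
  "carrier (localization R S) = {fraction R S a s | a s. a \<in> carrier R \<and> s \<in> S}"
  by (auto simp: localization_def quotient_def fraction_def)

lemma fraction_self: "a \<in> carrier R \<Longrightarrow> s \<in> S \<Longrightarrow> (a, s) \<in> fraction R S a s"
  unfolding fraction_def by (rule equiv_class_self[OF equiv_frac_rel]) auto

lemma fraction_memD:
  assumes "(a', s') \<in> fraction R S a s" "a \<in> carrier R" "s \<in> S"
  shows "a' \<in> carrier R" "s' \<in> S" "\<exists>u \<in> S. u \<otimes> (s' \<otimes> a) = u \<otimes> (s \<otimes> a')"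
  using assms by (auto simp: fraction_def frac_rel_def)

lemma localization_mult:
  assumes "a \<in> carrier R" "s \<in> S" "b \<in> carrier R" "t \<in> S"
  shows "fraction R S a s \<otimes>\<^bsub>localization R S\<^esub> fraction R S b t = fraction R S (a \<otimes> b) (s \<otimes> t)"
proof -
  have *: "fraction R S (a' \<otimes> b') (s' \<otimes> t') = fraction R S (a \<otimes> b) (s \<otimes> t)"
    if p: "(a', s') \<in> fraction R S a s" and q: "(b', t') \<in> fraction R S b t" for a' s' b' t'
  proof -
    note P = fraction_memD[OF p assms(1,2)] and Q = fraction_memD[OF q assms(3,4)]
    obtain u where u: "u \<in> S" "u \<otimes> (s' \<otimes> a) = u \<otimes> (s \<otimes> a')" using P(3) by blast
    obtain v where v: "v \<in> S" "v \<otimes> (t' \<otimes> b) = v \<otimes> (t \<otimes> b')" using Q(3) by blast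
    have "(u \<otimes> v) \<otimes> ((s \<otimes> t) \<otimes> (a' \<otimes> b')) = (u \<otimes> (s \<otimes> a')) \<otimes> (v \<otimes> (t \<otimes> b'))"
      using P(1,2) Q(1,2) u(1) v(1) assms by (simp add: m_ac)
    also have "\<dots> = (u \<otimes> (s' \<otimes> a)) \<otimes> (v \<otimes> (t' \<otimes> b))" by (simp only: u(2) v(2))
    also have "\<dots> = (u \<otimes> v) \<otimes> ((s' \<otimes> t') \<otimes> (a \<otimes> b))"
      using P(1,2) Q(1,2) u(1) v(1) assms by (simp add: m_ac)
    finally have "(u \<otimes> v) \<otimes> ((s \<otimes> t) \<otimes> (a' \<otimes> b')) = (u \<otimes> v) \<otimes> ((s' \<otimes> t') \<otimes> (a \<otimes> b))" .
    moreover have "u \<otimes> v \<in> S" using u v by (auto intro: m_closed)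
    ultimately show ?thesis using P(1,2) Q(1,2) assms
      by (subst fraction_eq_iff) (auto intro: m_closed)
  qed
  have "(\<Union>(a', s') \<in> fraction R S a s. \<Union>(b', t') \<in> fraction R S b t. fraction R S (a' \<otimes> b') (s' \<otimes> t'))
      = fraction R S (a \<otimes> b) (s \<otimes> t)"
    using * fraction_self[OF assms(1,2)] fraction_self[OF assms(3,4)] by fast
  then show ?thesis by (simp add: localization_def)
qed

lemma localization_add:
  assumes "a \<in> carrier R" "s \<in> S" "b \<in> carrier R" "t \<in> S"
  shows "fraction R S a s \<oplus>\<^bsub>localization R S\<^esub> fraction R S b t
    = fraction R S (a \<otimes> t \<oplus> b \<otimes> s) (s \<otimes> t)"
proof -
  have *: "fraction R S (a' \<otimes> t' \<oplus> b' \<otimes> s') (s' \<otimes> t') = fraction R S (a \<otimes> t \<oplus> b \<otimes> s) (s \<otimes> t)"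
    if p: "(a', s') \<in> fraction R S a s" and q: "(b', t') \<in> fraction R S b t" for a' s' b' t'
  proof -
    note P = fraction_memD[OF p assms(1,2)] and Q = fraction_memD[OF q assms(3,4)]
    obtain u where u: "u \<in> S" "u \<otimes> (s' \<otimes> a) = u \<otimes> (s \<otimes> a')" using P(3) by blast
    obtain v where v: "v \<in> S" "v \<otimes> (t' \<otimes> b) = v \<otimes> (t \<otimes> b')" using Q(3) by blast
    note c = P(1,2) Q(1,2) u(1) v(1) assms
    have "(u \<otimes> v) \<otimes> ((s \<otimes> t) \<otimes> (a' \<otimes> t' \<oplus> b' \<otimes> s'))
        = (v \<otimes> t \<otimes> t') \<otimes> (u \<otimes> (s \<otimes> a')) \<oplus> (u \<otimes> s \<otimes> s') \<otimes> (v \<otimes> (t \<otimes> b'))"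
      using c by (simp add: m_ac r_distr)
    also have "\<dots> = (v \<otimes> t \<otimes> t') \<otimes> (u \<otimes> (s' \<otimes> a)) \<oplus> (u \<otimes> s \<otimes> s') \<otimes> (v \<otimes> (t' \<otimes> b))"
      by (simp only: u(2) v(2))
    also have "\<dots> = (u \<otimes> v) \<otimes> ((s' \<otimes> t') \<otimes> (a \<otimes> t \<oplus> b \<otimes> s))"
      using c by (simp add: m_ac r_distr)
    finally have "(u \<otimes> v) \<otimes> ((s \<otimes> t) \<otimes> (a' \<otimes> t' \<oplus> b' \<otimes> s'))
        = (u \<otimes> v) \<otimes> ((s' \<otimes> t') \<otimes> (a \<otimes> t \<oplus> b \<otimes> s))" .
    moreover have "u \<otimes> v \<in> S" using u v by (auto intro: m_closed)
    ultimately show ?thesis using c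
      by (subst fraction_eq_iff) (auto intro: m_closed)
  qed
  have "(\<Union>(a', s') \<in> fraction R S a s. \<Union>(b', t') \<in> fraction R S b t.
        fraction R S (a' \<otimes> t' \<oplus> b' \<otimes> s') (s' \<otimes> t'))
      = fraction R S (a \<otimes> t \<oplus> b \<otimes> s) (s \<otimes> t)"
    using * fraction_self[OF assms(1,2)] fraction_self[OF assms(3,4)] by fast
  then show ?thesis by (simp add: localization_def)
qed

lemma localization_one: "\<one>\<^bsub>localization R S\<^esub> = fraction R S \<one> \<one>"
  by (simp add: localization_def)

lemma localization_zero: "\<zero>\<^bsub>localization R S\<^esub> = fraction R S \<zero> \<one>"
  by (simp add: localization_def)

lemma fraction_closed [simp, intro]:
  "a \<in> carrier R \<Longrightarrow> s \<in> S \<Longrightarrow> fraction R S a s \<in> carrier (localization R S)"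
  by (auto simp: localization_carrier)

lemma cring_localization: "cring (localization R S)"
proof -
  let ?L = "localization R S"
  note rules [simp] = localization_mult localization_add localization_one localization_zero
    submonoid.m_closed[OF submonoid_axioms]
  have fraction_cases: thesis
    if "x \<in> carrier ?L" "\<And>a s. a \<in> carrier R \<Longrightarrow> s \<in> S \<Longrightarrow> x = fraction R S a s \<Longrightarrow> thesis" for x thesis
    using that by (auto simp: localization_carrier)
  show ?thesis
  proof (rule cringI)
    show "abelian_group ?L"
    proof (rule abelian_groupI)
      fix x y assume "x \<in> carrier ?L" "y \<in> carrier ?L"
      then obtain a s b t where *: "a \<in> carrier R" "s \<in> S" "b \<in> carrier R" "t \<in> S"
        and xy: "x = fraction R S a s" "y = fraction R S b t"
        by (elim fraction_cases)
      show "x \<oplus>\<^bsub>?L\<^esub> y \<in> carrier ?L"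
        unfolding xy using * by simp
      have "a \<otimes> t \<oplus> b \<otimes> s = b \<otimes> s \<oplus> a \<otimes> t" "s \<otimes> t = t \<otimes> s"
        using * by (simp_all add: a_comm m_comm)
      then show "x \<oplus>\<^bsub>?L\<^esub> y = y \<oplus>\<^bsub>?L\<^esub> x"
        unfolding xy using * by simp
    next
      fix x y z assume "x \<in> carrier ?L" "y \<in> carrier ?L" "z \<in> carrier ?L"
      then obtain a s b t c w where *:
        "a \<in> carrier R" "s \<in> S" "b \<in> carrier R" "t \<in> S" "c \<in> carrier R" "w \<in> S"
        and xyz: "x = fraction R S a s" "y = fraction R S b t" "z = fraction R S c w"
        by (elim fraction_cases)
      have "(a \<otimes> t \<oplus> b \<otimes> s) \<otimes> w \<oplus> c \<otimes> (s \<otimes> t) = a \<otimes> (t \<otimes> w) \<oplus> (b \<otimes> w \<oplus> c \<otimes> t) \<otimes> s"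
        using * by (simp add: l_distr r_distr m_ac a_assoc)
      then show "x \<oplus>\<^bsub>?L\<^esub> y \<oplus>\<^bsub>?L\<^esub> z = x \<oplus>\<^bsub>?L\<^esub> (y \<oplus>\<^bsub>?L\<^esub> z)"
        unfolding xyz using * by (simp add: m_assoc)
    next
      show "\<zero>\<^bsub>?L\<^esub> \<in> carrier ?L" by simp
    next
      fix x assume "x \<in> carrier ?L"
      then obtain a s where *: "a \<in> carrier R" "s \<in> S" and x: "x = fraction R S a s"
        by (elim fraction_cases)
      show "\<zero>\<^bsub>?L\<^esub> \<oplus>\<^bsub>?L\<^esub> x = x"
        unfolding x using * by simp
      have "fraction R S (\<ominus> a) s \<oplus>\<^bsub>?L\<^esub> x = fraction R S (\<ominus> a \<otimes> s \<oplus> a \<otimes> s) (s \<otimes> s)"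
        unfolding x using * by simp
      also have "\<ominus> a \<otimes> s \<oplus> a \<otimes> s = \<zero>"
        using * by (simp add: l_minus l_neg)
      also have "fraction R S \<zero> (s \<otimes> s) = \<zero>\<^bsub>?L\<^esub>"
        using * by (simp add: fraction_eqI)
      finally show "\<exists>y \<in> carrier ?L. y \<oplus>\<^bsub>?L\<^esub> x = \<zero>\<^bsub>?L\<^esub>" using * by blast
    qed
  next
    show "comm_monoid ?L"
    proof (rule comm_monoidI)
      fix x y assume "x \<in> carrier ?L" "y \<in> carrier ?L"
      then obtain a s b t where *: "a \<in> carrier R" "s \<in> S" "b \<in> carrier R" "t \<in> S"
        and xy: "x = fraction R S a s" "y = fraction R S b t"
        by (elim fraction_cases)
      show "x \<otimes>\<^bsub>?L\<^esub> y \<in> carrier ?L"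
        unfolding xy using * by simp
      show "x \<otimes>\<^bsub>?L\<^esub> y = y \<otimes>\<^bsub>?L\<^esub> x"
        unfolding xy using * by (simp add: m_comm)
    next
      fix x y z assume "x \<in> carrier ?L" "y \<in> carrier ?L" "z \<in> carrier ?L"
      then obtain a s b t c w where *:
        "a \<in> carrier R" "s \<in> S" "b \<in> carrier R" "t \<in> S" "c \<in> carrier R" "w \<in> S"
        and xyz: "x = fraction R S a s" "y = fraction R S b t" "z = fraction R S c w"
        by (elim fraction_cases)
      show "x \<otimes>\<^bsub>?L\<^esub> y \<otimes>\<^bsub>?L\<^esub> z = x \<otimes>\<^bsub>?L\<^esub> (y \<otimes>\<^bsub>?L\<^esub> z)"
        unfolding xyz using * by (simp add: m_assoc)
    next
      show "\<one>\<^bsub>?L\<^esub> \<in> carrier ?L" by simp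
    next
      fix x assume "x \<in> carrier ?L"
      then obtain a s where *: "a \<in> carrier R" "s \<in> S" and x: "x = fraction R S a s"
        by (elim fraction_cases)
      show "\<one>\<^bsub>?L\<^esub> \<otimes>\<^bsub>?L\<^esub> x = x"
        unfolding x using * by simp
    qed
  next
    fix x y z assume "x \<in> carrier ?L" "y \<in> carrier ?L" "z \<in> carrier ?L"
    then obtain a s b t c w where *:
      "a \<in> carrier R" "s \<in> S" "b \<in> carrier R" "t \<in> S" "c \<in> carrier R" "w \<in> S"
      and xyz: "x = fraction R S a s" "y = fraction R S b t" "z = fraction R S c w"
      by (elim fraction_cases)
    have "fraction R S ((a \<otimes> t \<oplus> b \<otimes> s) \<otimes> c) (s \<otimes> t \<otimes> w)
        = fraction R S (a \<otimes> c \<otimes> (t \<otimes> w) \<oplus> b \<otimes> c \<otimes> (s \<otimes> w)) (s \<otimes> w \<otimes> (t \<otimes> w))"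
      by (rule fraction_eqI) (use * in \<open>simp_all add: r_distr l_distr m_ac\<close>)
    then show "(x \<oplus>\<^bsub>?L\<^esub> y) \<otimes>\<^bsub>?L\<^esub> z = x \<otimes>\<^bsub>?L\<^esub> z \<oplus>\<^bsub>?L\<^esub> y \<otimes>\<^bsub>?L\<^esub> z"
      unfolding xyz using * by simp
  qed
qed

end

lemma mult_system_image_compl_prime:
  assumes "cring R" "cring A" "\<psi> \<in> ring_hom R A" "primeideal P R"
  shows "mult_system A (\<psi> ` (carrier R - P))"
proof -
  interpret primeideal P R by fact
  interpret A: cring A by fact
  have "\<one>\<^bsub>R\<^esub> \<in> carrier R - P"
    using I_notcarr one_imp_carrier by auto
  then have one: "\<one>\<^bsub>A\<^esub> \<in> \<psi> ` (carrier R - P)"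
    using ring_hom_one[OF assms(3)] by force
  have "\<psi> x \<otimes>\<^bsub>A\<^esub> \<psi> y \<in> \<psi> ` (carrier R - P)"
    if "x \<in> carrier R - P" "y \<in> carrier R - P" for x y
  proof -
    have "x \<otimes>\<^bsub>R\<^esub> y \<in> carrier R - P" using that I_prime by blast
    moreover have "\<psi> x \<otimes>\<^bsub>A\<^esub> \<psi> y = \<psi> (x \<otimes>\<^bsub>R\<^esub> y)"
      using ring_hom_mult[OF assms(3)] that by simp
    ultimately show ?thesis by simp
  qed
  then have "submonoid (\<psi> ` (carrier R - P)) A"
    using one ring_hom_closed[OF assms(3)] by unfold_locales auto
  then show ?thesis
    by (intro mult_system.intro assms)
qed

end

theory Submission
  imports Defs "HOL-Algebra.QuotRing"
begin

text \<open>
  Suppose that \<open>Spec A\<close> is the disjoint union of two open sets, the complements of \<open>V(E)\<close> and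
  \<open>V(F)\<close>.  Then \<open>E\<close> and \<open>F\<close> generate comaximal ideals, and writing \<open>\<one>\<close> as a sum of an element of
  each yields \<open>a, b \<in> A\<close> such that the two open sets are the basic open sets \<open>D(a)\<close> and \<open>D(b)\<close>
  (\<open>open_partition_basic_open\<close>).  This turns the topological question into one about units, since
  a basic open set is the whole spectrum iff its element is a unit (\<open>Units_iff_basic_open\<close>).

  For a prime \<open>P\<close> of \<open>R\<close> the preimages of \<open>D(a)\<close> and \<open>D(b)\<close> form an open partition of
  \<open>Spec A\<^sub>P\<close>, which is connected and nonempty.  Hence exactly one of \<open>a\<close> and \<open>b\<close> becomes a unit in
  \<open>A\<^sub>P\<close> (\<open>connected_Spec_exactly_one_unit\<close>).  Now \<open>a\<close> is a unit in \<open>A\<^sub>P\<close> iff some element of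
  \<open>\<psi> (R - P)\<close> is a multiple of \<open>a\<close>, that is, iff \<open>P\<close> does not contain the ideal \<open>\<psi>\<inverse>(aA)\<close> of \<open>R\<close>
  (\<open>fraction_one_Units_iff\<close>, \<open>Units_localization_prime_iff\<close>).  This is an open condition on \<open>P\<close>, and
  so is the one for \<open>b\<close>.  Since \<open>Spec R\<close> is connected, one of the two elements, say \<open>a\<close>, is a unit in
  every \<open>A\<^sub>P\<close>.  Then \<open>\<psi>\<inverse>(aA)\<close> lies in no prime of \<open>R\<close>, so it contains \<open>\<one>\<close>, and \<open>a\<close> is a unit of
  \<open>A\<close>.  Thus \<open>D(a)\<close> is all of \<open>Spec A\<close> and the partition is trivial.

  Nonemptiness of \<open>Spec A\<close> is inherited from any of the \<open>Spec A\<^sub>P\<close>, by pulling back a prime of \<open>A\<^sub>P\<close>.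
\<close>


section \<open>Primes containing a given ideal\<close>

text \<open>Zorn's lemma applies to the ideals above \<open>I\<close> that omit \<open>\<one>\<close>, because a union of a
  nonempty chain of such ideals is again one.\<close>

lemma (in cring) proper_ideal_subset_prime:
  assumes "ideal I R" and "\<one> \<notin> I"
  obtains P where "P \<in> prime_ideals R" and "I \<subseteq> P"
proof -
  let ?F = "{J. ideal J R \<and> I \<subseteq> J \<and> \<one> \<notin> J}"
  have "\<exists>M\<in>?F. \<forall>J\<in>?F. M \<subseteq> J \<longrightarrow> J = M"
  proof (rule subset_Zorn_nonempty)
    show "?F \<noteq> {}" using assms by blast
  next
    fix C assume ne: "C \<noteq> {}" and ch: "subset.chain ?F C"
    then have C: "ideal J R" "I \<subseteq> J" "\<one> \<notin> J" if "J \<in> C" for J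
      using that unfolding subset_chain_def by blast+
    have add: "x \<oplus> y \<in> \<Union>C" if xy: "x \<in> \<Union>C" "y \<in> \<Union>C" for x y
    proof -
      obtain J K where JK: "J \<in> C" "x \<in> J" "K \<in> C" "y \<in> K" using xy by blast
      then have "J \<subseteq> K \<or> K \<subseteq> J" using ch unfolding subset_chain_def by blast
      then obtain M where "M \<in> C" "x \<in> M" "y \<in> M" using JK by blast
      then show ?thesis
        using additive_subgroup.a_closed[OF ideal.axioms(1)[OF C(1)]] by blast
    qed
    have "ideal (\<Union>C) R"
    proof (rule idealI)
      show "ring R" by (rule ring_axioms)
      show "subgroup (\<Union>C) (add_monoid R)"
      proof (rule add.subgroupI)
        show "\<Union>C \<subseteq> carrier R" using ideal.Icarr[OF C(1)] by blast
        show "\<Union>C \<noteq> {}"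
          using ne additive_subgroup.zero_closed[OF ideal.axioms(1)[OF C(1)]] by blast
        show "\<ominus> x \<in> \<Union>C" if "x \<in> \<Union>C" for x
          using that additive_subgroup.a_inv_closed[OF ideal.axioms(1)[OF C(1)]] by blast
        show "x \<oplus> y \<in> \<Union>C" if "x \<in> \<Union>C" "y \<in> \<Union>C" for x y
          using add[OF that] .
      qed
      show "x \<otimes> a \<in> \<Union>C" if "a \<in> \<Union>C" "x \<in> carrier R" for a x
        using that ideal.I_l_closed[OF C(1)] by blast
      show "a \<otimes> x \<in> \<Union>C" if "a \<in> \<Union>C" "x \<in> carrier R" for a x
        using that ideal.I_r_closed[OF C(1)] by blast
    qed
    moreover have "I \<subseteq> \<Union>C" using ne C(2) by blast
    moreover have "\<one> \<notin> \<Union>C" using C(3) by blast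
    ultimately show "\<Union>C \<in> ?F" by simp
  qed
  then obtain M where M: "ideal M R" "I \<subseteq> M" "\<one> \<notin> M"
    and max: "\<And>J. ideal J R \<Longrightarrow> I \<subseteq> J \<Longrightarrow> \<one> \<notin> J \<Longrightarrow> M \<subseteq> J \<Longrightarrow> J = M"
    by auto
  have "maximalideal M R"
  proof (rule maximalidealI[OF M(1)])
    show "carrier R \<noteq> M" using M(3) by blast
    show "J = M \<or> J = carrier R" if "ideal J R" "M \<subseteq> J" "J \<subseteq> carrier R" for J
      using max[OF that(1)] M(2) that(2) ideal.one_imp_carrier[OF that(1)] by blast
  qed
  then have "M \<in> prime_ideals R"
    using maximalideal_prime by (simp add: prime_ideals_def)
  then show thesis using that M(2) by blast
qed


section \<open>Basic open sets of the spectrum\<close>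

definition basic_open :: "('a, 'm) ring_scheme \<Rightarrow> 'a \<Rightarrow> 'a set set" where
  "basic_open R a = {P \<in> prime_ideals R. a \<notin> P}"

lemma openin_basic_open: "a \<in> carrier R \<Longrightarrow> openin (Spec R) (basic_open R a)"
  unfolding openin_Spec basic_open_def by (intro exI[of _ "{a}"]) auto

lemma (in cring) Units_iff_basic_open:
  assumes a: "a \<in> carrier R"
  shows "a \<in> Units R \<longleftrightarrow> basic_open R a = prime_ideals R"
proof
  assume u: "a \<in> Units R"
  have "a \<notin> P" if "P \<in> prime_ideals R" for P
  proof
    assume aP: "a \<in> P"
    interpret primeideal P R using that by (simp add: prime_ideals_def)
    have "inv a \<otimes> a \<in> P" using aP u by (intro I_l_closed) auto
    then show False using u I_notcarr one_imp_carrier by simp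
  qed
  then show "basic_open R a = prime_ideals R" by (auto simp: basic_open_def)
next
  assume D: "basic_open R a = prime_ideals R"
  have "\<one> \<in> PIdl a"
  proof (rule ccontr)
    assume "\<one> \<notin> PIdl a"
    then obtain P where "P \<in> prime_ideals R" "PIdl a \<subseteq> P"
      using proper_ideal_subset_prime[OF cgenideal_ideal[OF a]] by blast
    then show False using D cgenideal_self[OF a] by (auto simp: basic_open_def)
  qed
  then obtain x where x: "x \<in> carrier R" "x \<otimes> a = \<one>"
    unfolding cgenideal_def by auto
  moreover have "a \<otimes> x = \<one>" using x m_comm[OF a x(1)] by simp
  ultimately show "a \<in> Units R" using a unfolding Units_def by blast
qed

text \<open>Let the open sets be the complements of \<open>V(E)\<close> and \<open>V(F)\<close>.  As the open sets cover the
  spectrum, no prime contains both \<open>E\<close> and \<open>F\<close>, so \<open>\<one> = a \<oplus> b\<close> with \<open>a\<close> in the ideal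
  of \<open>E\<close> and \<open>b\<close> in the ideal of \<open>F\<close>.  As they are disjoint, every prime contains \<open>E\<close> or \<open>F\<close>, hence
  contains \<open>a\<close> or \<open>b\<close>; it cannot contain both, since their sum is \<open>\<one>\<close>.\<close>

lemma (in cring) open_partition_basic_open:
  assumes "openin (Spec R) U" and "openin (Spec R) V"
    and cover: "prime_ideals R \<subseteq> U \<union> V" and disj: "U \<inter> V = {}"
  obtains a b where "a \<in> carrier R" and "b \<in> carrier R"
    and "U = basic_open R a" and "V = basic_open R b"
proof -
  obtain E F where E: "E \<subseteq> carrier R" "U = {P \<in> prime_ideals R. \<not> E \<subseteq> P}"
    and F: "F \<subseteq> carrier R" "V = {P \<in> prime_ideals R. \<not> F \<subseteq> P}"
    using assms(1,2) unfolding openin_Spec by blast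
  note IE = genideal_ideal[OF E(1)] and IF = genideal_ideal[OF F(1)]
  have sub: "Idl E \<union> Idl F \<subseteq> carrier R"
    using IE IF by (auto dest: ideal.Icarr)
  have "\<one> \<in> Idl (Idl E \<union> Idl F)"
  proof (rule ccontr)
    assume "\<one> \<notin> Idl (Idl E \<union> Idl F)"
    then obtain P where "P \<in> prime_ideals R" "Idl (Idl E \<union> Idl F) \<subseteq> P"
      using proper_ideal_subset_prime[OF genideal_ideal[OF sub]] by blast
    moreover from this have "E \<subseteq> P" "F \<subseteq> P"
      using genideal_self[OF sub] genideal_self[OF E(1)] genideal_self[OF F(1)] by auto
    ultimately show False using cover E(2) F(2) by blast
  qed
  then obtain a b where ab: "a \<in> Idl E" "b \<in> Idl F" "\<one> = a \<oplus> b"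
    unfolding union_genideal[OF IE IF] set_add_def' by blast
  have *: "(P \<in> U \<longleftrightarrow> a \<notin> P) \<and> (P \<in> V \<longleftrightarrow> b \<notin> P)" if P: "P \<in> prime_ideals R" for P
  proof -
    interpret primeideal P R using P by (simp add: prime_ideals_def)
    have "a \<notin> P \<or> b \<notin> P"
      using ab(3) a_closed[of a b] I_notcarr one_imp_carrier by auto
    moreover have "a \<in> P" if "E \<subseteq> P" using that ab(1) genideal_minimal[OF is_ideal] by blast
    moreover have "b \<in> P" if "F \<subseteq> P" using that ab(2) genideal_minimal[OF is_ideal] by blast
    ultimately show ?thesis using P E(2) F(2) cover disj by blast
  qed
  have eq: "U = basic_open R a" "V = basic_open R b"
    using * E(2) F(2) by (auto simp: basic_open_def)
  have "a \<in> carrier R" "b \<in> carrier R" using ab(1,2) sub by auto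
  then show thesis by (rule that[OF _ _ eq])
qed


section \<open>Functoriality\<close>

lemma prime_ideals_vimage:
  assumes "cring A" and "cring B" and h: "h \<in> ring_hom A B" and Q: "Q \<in> prime_ideals B"
  shows "{x \<in> carrier A. h x \<in> Q} \<in> prime_ideals A"
proof -
  interpret A: cring A by fact
  interpret B: cring B by fact
  interpret ring_hom_ring A B h
    using h by (intro ring_hom_ringI2 A.ring_axioms B.ring_axioms)
  interpret Q: primeideal Q B using Q by (simp add: prime_ideals_def)
  have "primeideal {x \<in> carrier A. h x \<in> Q} A"
  proof (rule primeidealI)
    show "ideal {x \<in> carrier A. h x \<in> Q} A" by (rule ideal_vimage[OF Q.is_ideal])
    show "cring A" by fact
    show "carrier A \<noteq> {x \<in> carrier A. h x \<in> Q}"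
      using Q.I_notcarr Q.one_imp_carrier A.one_closed hom_one by force
  qed (use Q.I_prime in auto)
  then show ?thesis by (simp add: prime_ideals_def)
qed

text \<open>The preimages of the two basic open sets in \<open>Spec B\<close> are the basic open sets of \<open>h a\<close> and
  \<open>h b\<close>.  One of them is empty and the other one is everything.\<close>

lemma connected_Spec_exactly_one_unit:
  assumes "cring A" and "cring B" and h: "h \<in> ring_hom A B"
    and conn: "nonempty_connected_space (Spec B)"
    and ab: "a \<in> carrier A" "b \<in> carrier A"
    and cover: "prime_ideals A \<subseteq> basic_open A a \<union> basic_open A b"
    and disj: "basic_open A a \<inter> basic_open A b = {}"
  shows "h a \<in> Units B \<longleftrightarrow> h b \<notin> Units B"
proof -
  interpret B: cring B by fact
  have hab: "h a \<in> carrier B" "h b \<in> carrier B"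
    using ab ring_hom_closed[OF h] by auto
  have *: "h a \<in> Q \<longleftrightarrow> h b \<notin> Q" if "Q \<in> prime_ideals B" for Q
    using prime_ideals_vimage[OF assms(1-3) that] cover disj ab
    by (auto simp: basic_open_def)
  then have cover': "topspace (Spec B) \<subseteq> basic_open B (h a) \<union> basic_open B (h b)"
    and disj': "basic_open B (h a) \<inter> basic_open B (h b) = {}"
    by (auto simp: topspace_Spec basic_open_def)
  have "basic_open B (h a) = {} \<or> basic_open B (h b) = {}"
    using connected_spaceD[OF _ openin_basic_open[OF hab(1)] openin_basic_open[OF hab(2)]
        cover' disj'] conn
    by (auto simp: nonempty_connected_space_def)
  moreover have "prime_ideals B \<noteq> {}"
    using conn by (simp add: nonempty_connected_space_def topspace_Spec)
  moreover have "basic_open B (h a) \<subseteq> prime_ideals B" "basic_open B (h b) \<subseteq> prime_ideals B"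
    by (auto simp: basic_open_def)
  ultimately show ?thesis
    unfolding B.Units_iff_basic_open[OF hab(1)] B.Units_iff_basic_open[OF hab(2)]
    using cover' disj' by (auto simp: topspace_Spec)
qed


section \<open>Units in a localization\<close>

lemma (in mult_system) fraction_one_ring_hom:
  "(\<lambda>a. fraction R S a \<one>) \<in> ring_hom R (localization R S)"
  by (rule ring_hom_memI) (simp_all add: localization_mult localization_add localization_one)

text \<open>An inverse \<open>c / s\<close> of \<open>a / \<one>\<close> gives only \<open>u \<otimes> (c \<otimes> a) = u \<otimes> s\<close> for some \<open>u \<in> S\<close>, so it is
  \<open>u \<otimes> c\<close> that multiplies \<open>a\<close> into \<open>S\<close>.\<close>

lemma (in mult_system) fraction_one_Units_iff:
  assumes a: "a \<in> carrier R"
  shows "fraction R S a \<one> \<in> Units (localization R S) \<longleftrightarrow> (\<exists>c \<in> carrier R. c \<otimes> a \<in> S)"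
proof -
  interpret L: cring "localization R S" by (rule cring_localization)
  show ?thesis
  proof
    assume "fraction R S a \<one> \<in> Units (localization R S)"
    then obtain y where "y \<in> carrier (localization R S)"
      "y \<otimes>\<^bsub>localization R S\<^esub> fraction R S a \<one> = \<one>\<^bsub>localization R S\<^esub>"
      using L.Units_l_inv_ex L.Units_closed by blast
    then obtain c s where cs: "c \<in> carrier R" "s \<in> S"
      "fraction R S c s \<otimes>\<^bsub>localization R S\<^esub> fraction R S a \<one> = \<one>\<^bsub>localization R S\<^esub>"
      by (auto simp: localization_carrier)
    then have "fraction R S (c \<otimes> a) s = fraction R S \<one> \<one>"
      using a by (simp add: localization_mult localization_one)
    then obtain u where u: "u \<in> S" "u \<otimes> (c \<otimes> a) = u \<otimes> s"
      using a cs by (auto simp: fraction_eq_iff)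
    then have "(u \<otimes> c) \<otimes> a \<in> S" using a cs by (simp add: m_assoc)
    then show "\<exists>c \<in> carrier R. c \<otimes> a \<in> S" using u cs by blast
  next
    assume "\<exists>c \<in> carrier R. c \<otimes> a \<in> S"
    then obtain c where c: "c \<in> carrier R" "c \<otimes> a \<in> S" by blast
    have frac: "fraction R S c (c \<otimes> a) \<in> carrier (localization R S)"
      "fraction R S a \<one> \<in> carrier (localization R S)"
      using a c by auto
    moreover have "fraction R S (c \<otimes> a) (c \<otimes> a) = fraction R S \<one> \<one>"
      using a c by (intro fraction_eqI) auto
    then have "fraction R S c (c \<otimes> a) \<otimes>\<^bsub>localization R S\<^esub> fraction R S a \<one>
        = \<one>\<^bsub>localization R S\<^esub>"
      using a c by (simp add: localization_mult localization_one)
    moreover from this have "fraction R S a \<one> \<otimes>\<^bsub>localization R S\<^esub> fraction R S c (c \<otimes> a)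
        = \<one>\<^bsub>localization R S\<^esub>"
      using L.m_comm[OF frac] by simp
    ultimately show "fraction R S a \<one> \<in> Units (localization R S)"
      unfolding Units_def by blast
  qed
qed

lemma Units_localization_prime_iff:
  assumes "cring R" and "cring A" and \<psi>: "\<psi> \<in> ring_hom R A"
    and P: "P \<in> prime_ideals R" and a: "a \<in> carrier A"
  defines "S \<equiv> \<psi> ` (carrier R - P)"
  shows "fraction A S a \<one>\<^bsub>A\<^esub> \<in> Units (localization A S)
    \<longleftrightarrow> \<not> {r \<in> carrier R. \<psi> r \<in> PIdl\<^bsub>A\<^esub> a} \<subseteq> P"
proof -
  interpret mult_system A S
    unfolding S_def using assms(1-3) P
    by (intro mult_system_image_compl_prime) (simp_all add: prime_ideals_def)
  have "(\<exists>c \<in> carrier A. c \<otimes>\<^bsub>A\<^esub> a \<in> S) \<longleftrightarrow> (\<exists>r \<in> carrier R - P. \<psi> r \<in> PIdl\<^bsub>A\<^esub> a)"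
    unfolding S_def cgenideal_def image_iff mem_Collect_eq by metis
  also have "\<dots> \<longleftrightarrow> \<not> {r \<in> carrier R. \<psi> r \<in> PIdl\<^bsub>A\<^esub> a} \<subseteq> P" by auto
  finally show ?thesis unfolding fraction_one_Units_iff[OF a] .
qed

text \<open>Being a unit is a local condition over the base: an ideal of \<open>R\<close> that is contained in no
  prime contains \<open>\<one>\<close>.\<close>

lemma Units_if_ideal_vimage_in_no_prime:
  assumes "cring R" and "cring A" and \<psi>: "\<psi> \<in> ring_hom R A" and a: "a \<in> carrier A"
    and no_prime: "\<And>P. P \<in> prime_ideals R \<Longrightarrow> \<not> {r \<in> carrier R. \<psi> r \<in> PIdl\<^bsub>A\<^esub> a} \<subseteq> P"
  shows "a \<in> Units A"
proof -
  interpret R: cring R by fact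
  interpret A: cring A by fact
  interpret ring_hom_ring R A \<psi>
    using \<psi> by (intro ring_hom_ringI2 R.ring_axioms A.ring_axioms)
  have "\<one>\<^bsub>R\<^esub> \<in> {r \<in> carrier R. \<psi> r \<in> PIdl\<^bsub>A\<^esub> a}"
    using R.proper_ideal_subset_prime[OF ideal_vimage[OF A.cgenideal_ideal[OF a]]] no_prime
    by blast
  then obtain c where c: "c \<in> carrier A" "c \<otimes>\<^bsub>A\<^esub> a = \<one>\<^bsub>A\<^esub>"
    by (auto simp: cgenideal_def)
  moreover have "a \<otimes>\<^bsub>A\<^esub> c = \<one>\<^bsub>A\<^esub>" using c A.m_comm[OF a c(1)] by simp
  ultimately show ?thesis using a unfolding Units_def by blast
qed


section \<open>Connectedness from base and localizations\<close>

theorem theorem5p1: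
  fixes R :: "('a, 'm) ring_scheme" and A :: "('b, 'n) ring_scheme" and \<psi> :: "'a \<Rightarrow> 'b"
  assumes "cring R" and "cring A" and "\<psi> \<in> ring_hom R A"
    and "nonempty_connected_space (Spec R)"
    and "\<And>P. P \<in> topspace (Spec R) \<Longrightarrow>
           nonempty_connected_space (Spec (localization A (\<psi> ` (carrier R - P))))"
  shows "nonempty_connected_space (Spec A)"
proof -
  interpret A: cring A by fact
  let ?S = "\<lambda>P. \<psi> ` (carrier R - P)"
  let ?N = "\<lambda>a. {r \<in> carrier R. \<psi> r \<in> PIdl\<^bsub>A\<^esub> a}"
  have loc: "mult_system A (?S P)" if "P \<in> prime_ideals R" for P
    using that assms(1-3) by (intro mult_system_image_compl_prime) (simp_all add: prime_ideals_def)
  have conn: "nonempty_connected_space (Spec (localization A (?S P)))" if "P \<in> prime_ideals R" for P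
    using assms(5) that by (simp add: topspace_Spec)
  have "prime_ideals A \<noteq> {}"
  proof -
    obtain P where P: "P \<in> prime_ideals R"
      using assms(4) by (auto simp: nonempty_connected_space_def topspace_Spec)
    then obtain Q where "Q \<in> prime_ideals (localization A (?S P))"
      using conn by (fastforce simp: nonempty_connected_space_def topspace_Spec)
    then show ?thesis
      using prime_ideals_vimage[OF \<open>cring A\<close> mult_system.cring_localization[OF loc[OF P]]
          mult_system.fraction_one_ring_hom[OF loc[OF P]]]
      by blast
  qed
  moreover have "connected_space (Spec A)"
    unfolding connected_space_def topspace_Spec
  proof clarify
    fix U V
    assume UV: "openin (Spec A) U" "openin (Spec A) V" "prime_ideals A \<subseteq> U \<union> V" "U \<inter> V = {}"
      and ne: "U \<noteq> {}" "V \<noteq> {}"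
    obtain a b where a: "a \<in> carrier A" "U = basic_open A a"
      and b: "b \<in> carrier A" "V = basic_open A b"
      using A.open_partition_basic_open[OF UV] by blast
    have not_unit: "x \<notin> Units A" if "x = a \<or> x = b" for x
    proof -
      have "basic_open A x \<noteq> prime_ideals A"
        using that UV(4) ne a b by (auto simp: basic_open_def)
      then show ?thesis using that A.Units_iff_basic_open a(1) b(1) by blast
    qed
    \<comment> \<open>exactly one of \<open>a\<close> and \<open>b\<close> becomes a unit in the localization at \<open>P\<close>\<close>
    have split: "\<not> ?N a \<subseteq> P \<longleftrightarrow> ?N b \<subseteq> P" if P: "P \<in> prime_ideals R" for P
      using connected_Spec_exactly_one_unit[OF \<open>cring A\<close>
          mult_system.cring_localization[OF loc[OF P]]
          mult_system.fraction_one_ring_hom[OF loc[OF P]] conn[OF P] a(1) b(1)] UV(3,4) a(2) b(2)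
      unfolding Units_localization_prime_iff[OF assms(1-3) P a(1)]
        Units_localization_prime_iff[OF assms(1-3) P b(1)]
      by simp
    define W where "W a = {P \<in> prime_ideals R. \<not> ?N a \<subseteq> P}" for a
    have W: "openin (Spec R) (W a)" for a
      unfolding openin_Spec W_def by (intro exI[of _ "?N a"]) auto
    have cover: "topspace (Spec R) \<subseteq> W a \<union> W b" and disj: "W a \<inter> W b = {}"
      unfolding topspace_Spec W_def using split by auto
    have "connected_space (Spec R)"
      using assms(4) by (simp add: nonempty_connected_space_def)
    then have "W a = {} \<or> W b = {}"
      using connected_spaceD[OF _ W W cover disj] by blast
    then have "prime_ideals R \<subseteq> W a \<or> prime_ideals R \<subseteq> W b"
      using cover by (auto simp: topspace_Spec)
    then have "(\<forall>P \<in> prime_ideals R. \<not> ?N a \<subseteq> P) \<or> (\<forall>P \<in> prime_ideals R. \<not> ?N b \<subseteq> P)"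
      unfolding W_def by fast
    then have "a \<in> Units A \<or> b \<in> Units A"
      using Units_if_ideal_vimage_in_no_prime[OF assms(1-3)] a(1) b(1) by blast
    then show False using not_unit by blast
  qed
  ultimately show ?thesis
    by (simp add: nonempty_connected_space_def topspace_Spec)
qed

end
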